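(* Let $a,v:[0,\infty)\to(0,\infty)$ be continuous, strictly increasing functions, regularly varying at infinity with indices $A>0$ and $V>0$ respectively, and put $a_n=a(n)$, $v_n=v(n)$ and $h=v\circ a^{-1}$. Let $d\ge1$ and let $\boldsymbol W=\{\boldsymbol W_n:n\in\mathbb N\}$, $\mathbb N=\{0,1,2,\dots\}$, be a sequence of random vectors in $\mathbb R^d$ satisfying the following hypotheses. 1. (Restricted LDP) There is a function $J_{\boldsymbol W}:[0,\infty)^d\to[0,\infty]$ such that for every $\boldsymbol q\ge\boldsymbol 0$ $$\lim_{n\to\infty}\frac1{v_n}\log\mathbb P\left(\frac{\boldsymbol W_n}{a_n}>\boldsymbol q\right)=-J_{\boldsymbol W}(\boldsymbol q).$$ 2. (Stability and continuity) $J_{\boldsymbol W}(\boldsymbol 0)>0$; there is $\boldsymbol y>\boldsymbol 0$ with $J_{\boldsymbol W}(\boldsymbol y)<\infty$; and $J_{\boldsymbol W}$ is continuous on the interior of $\{\boldsymbol x:J_{\boldsymbol W}(\boldsymbol x)<\infty\}$. 3. (Uniform individual decay rate) For every $\boldsymbol q>\boldsymbol 0$ there exist constants $F=F(\boldsymbol q)>V/A$ and $K=K(\boldsymbol q)>0$ such that for all $n\in\mathbb N$ and all $c>K$ $$\frac1{v_n}\log\mathbb P\left(\frac{\boldsymbol W_n}{a_n}>c\boldsymbol q\right)\le-c^F.$$ Then, for every $\boldsymbol q>\boldsymbol 0$ in $\mathbb R^d$, $$\lim_{u\to\infty}\frac1{h(u)}\log\mathbb P\left(\exists n\in\mathbb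 N:\boldsymbol W_n>u\boldsymbol q\right)=-\inf_{c>0}c^{-V/A}J_{\boldsymbol W}(c\boldsymbol q).$$
   Context: All vector inequalities are coordinatewise: $\boldsymbol x>\boldsymbol y$ means $x_i>y_i$ for all $i=1,\dots,d$, and $\boldsymbol x\ge\boldsymbol y$ means $x_i\ge y_i$ for all $i$. A function $f$ is regularly varying at infinity with index $\rho$ if $\lim_{t\to\infty}f(ct)/f(t)=c^\rho$ for every $c>0$. The inverse $a^{-1}$ is defined on the range of $a$, which contains all sufficiently large $u$, so $h(u)$ is defined for all large $u$. Convention: $\log 0=-\infty$. *)

theory Defs
  imports "HOL-Probability.Probability"
begin

(* On "real ^ 'd" the order "<=" is coordinatewise, but "<" only means "<= and not equal".
   The strict coordinatewise order is the library constant eucl_less, whose infix notation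
   the library withdraws again. *)
notation eucl_less (infix "<e" 50)

definition regularly_varying :: "(real \<Rightarrow> real) \<Rightarrow> real \<Rightarrow> bool" where
  "regularly_varying f \<rho> \<longleftrightarrow> (\<forall>c>0. ((\<lambda>t. f (c * t) / f t) \<longlongrightarrow> c powr \<rho>) at_top)"

(* Extended logarithm of a nonnegative real; needed because "ln 0 = 0" in HOL. *)
definition elog :: "real \<Rightarrow> ereal" where
  "elog p = (if p = 0 then - \<infinity> else ereal (ln p))"

end

theory Submission
  imports Defs "HOL-Real_Asymp.Real_Asymp"
begin

text \<open>
  Write \<open>t = a\<^sup>-\<^sup>1(u)\<close>, so that \<open>h(u) = v(t)\<close>, and let \<open>p n u\<close> be the probability that
  \<open>W n\<close> exceeds \<open>u q\<close> and \<open>j c = J (c q)\<close>. The exceedance \<open>W n > u q\<close> is the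
  event \<open>W n / a n > c q\<close> with \<open>c = u / a n\<close>. At a time \<open>n\<close> of order \<open>s t\<close> one has \<open>c\<close> close to
  \<open>s powr - A\<close> and \<open>v n\<close> close to \<open>s powr V * v t = c powr - (V / A) * v t\<close>, so such a time
  contributes a probability of about \<open>exp (- (v t * c powr - (V / A) * j c))\<close>. The infimum over \<open>c\<close>
  picks the most likely time scale.

  The lower bound (\<open>single_time_lower_bound\<close>) uses a single well-chosen \<open>n\<close>. For the upper bound
  let \<open>m\<close> be a positive number below the infimum. Three regimes of \<open>n\<close> are controlled separately,
  and in each of them the individual probabilities are at most \<open>exp (- (v t * m))\<close>:

  \<^item> \<open>n \<le> \<delta> t\<close> with \<open>\<delta>\<close> small (\<open>early_times\<close>): the uniform decay rate gives the exponent
    \<open>v n * (a t / a n) powr F\<close>, and since \<open>F > V / A\<close> the quotient \<open>a powr F / v\<close> grows like a positive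
    power (\<open>quotient_power_growth\<close>), which makes this exponent exceed any prescribed multiple of \<open>v t\<close>;
  \<^item> \<open>\<delta> t \<le> n \<le> L t\<close> (\<open>comparable_times\<close>): the ratio \<open>n / t\<close> stays in a compact interval, and
    around each value \<open>s\<close> of it one application of the large deviation limit, at a single point,
    handles a whole window, because \<open>p n\<close> is antitone;
  \<^item> \<open>n \<ge> L t\<close> with \<open>L\<close> large (\<open>late_times\<close>): here \<open>j 0 > 0\<close> suffices, because \<open>v n\<close> is then a large
    multiple of \<open>v t\<close>; moreover half of the exponent is left over to make the sum over \<open>n\<close>
    converge.

  The remaining factor, of order \<open>t\<close>, disappears after taking logarithms and dividing by \<open>v t\<close>.
\<close>

section \<open>Monotone regularly varying functions\<close>

locale regular_scale =
  fixes f :: "real \<Rightarrow> real" and \<rho> :: real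
  assumes pos: "0 \<le> t \<Longrightarrow> 0 < f t"
    and strict: "strict_mono_on {0..} f"
    and rv: "regularly_varying f \<rho>"
    and index_pos: "0 < \<rho>"
begin

lemma mono: "0 \<le> s \<Longrightarrow> s \<le> t \<Longrightarrow> f s \<le> f t"
  by (rule strict_mono_on_leD[OF strict]) auto

lemma eventually_le:
  assumes "0 < b" "b powr \<rho> < \<kappa>"
  shows "\<forall>\<^sub>F t in at_top. f (b * t) \<le> \<kappa> * f t"
proof -
  have "((\<lambda>t. f (b * t) / f t) \<longlongrightarrow> b powr \<rho>) at_top"
    using rv assms by (auto simp: regularly_varying_def)
  then have "\<forall>\<^sub>F t in at_top. f (b * t) / f t < \<kappa>"
    using assms by (auto dest: order_tendstoD)
  with eventually_ge_at_top[of 0] show ?thesis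
    by eventually_elim (use pos in \<open>auto simp: field_simps\<close>)
qed

lemma eventually_ge:
  assumes "0 < b" "\<theta> < b powr \<rho>"
  shows "\<forall>\<^sub>F t in at_top. \<theta> * f t \<le> f (b * t)"
proof -
  have "((\<lambda>t. f (b * t) / f t) \<longlongrightarrow> b powr \<rho>) at_top"
    using rv assms by (auto simp: regularly_varying_def)
  then have "\<forall>\<^sub>F t in at_top. f (b * t) / f t > \<theta>"
    using assms by (auto dest: order_tendstoD)
  with eventually_ge_at_top[of 0] show ?thesis
    by eventually_elim (use pos in \<open>auto simp: field_simps\<close>)
qed

end

text \<open>
  Iterating a doubling inequality gives power growth along the points \<open>2 ^ k * x\<close>; the weaker
  bound \<open>short\<close> then covers the gaps between them.
\<close>
lemma doubling_imp_power_growth: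
  fixes g :: "real \<Rightarrow> real"
  assumes X: "0 < X" "X \<le> x" "x \<le> t" and \<beta>: "0 < \<beta>" and C: "0 < C"
    and nonneg: "\<And>y. X \<le> y \<Longrightarrow> 0 \<le> g y"
    and double: "\<And>y. X \<le> y \<Longrightarrow> 2 powr \<beta> * g y \<le> g (2 * y)"
    and short: "\<And>y s. X \<le> y \<Longrightarrow> y \<le> s \<Longrightarrow> s \<le> 2 * y \<Longrightarrow> C * g y \<le> g s"
  shows "C * (t / (2 * x)) powr \<beta> * g x \<le> g t"
proof -
  have gen: "C * (t / (2 * x)) powr \<beta> * g x \<le> g t" if "x \<le> t" "t \<le> 2 ^ Suc k * x" for t k
    using that
  proof (induction k arbitrary: t)
    case 0
    have "(t / (2 * x)) powr \<beta> \<le> 1"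
      using 0 X \<beta> by (intro powr_le1) (auto simp: field_simps)
    then have "C * g x * (t / (2 * x)) powr \<beta> \<le> C * g x"
      using C nonneg[of x] X by (intro mult_left_le) auto
    also have "\<dots> \<le> g t" using 0 X by (intro short) auto
    finally show ?case by (simp add: mult_ac)
  next
    case (Suc k)
    show ?case
    proof (cases "t \<le> 2 * x")
      case True
      have "1 * (2 * x) \<le> 2 ^ k * (2 * x)" using X by (intro mult_right_mono) auto
      then have "t \<le> 2 ^ Suc k * x" using True by (simp add: mult_ac)
      then show ?thesis using Suc.IH Suc.prems by blast
    next
      case False
      have "C * ((t / 2) / (2 * x)) powr \<beta> * g x \<le> g (t / 2)"
        using Suc.prems False by (intro Suc.IH) auto
      then have "2 powr \<beta> * (C * ((t / 2) / (2 * x)) powr \<beta> * g x) \<le> 2 powr \<beta> * g (t / 2)"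
        by (intro mult_left_mono) auto
      also have "\<dots> \<le> g (2 * (t / 2))" using False X by (intro double) auto
      also have "2 powr \<beta> * (C * ((t / 2) / (2 * x)) powr \<beta> * g x)
          = C * (2 * ((t / 2) / (2 * x))) powr \<beta> * g x"
        using False X by (subst powr_mult) auto
      finally show ?thesis by simp
    qed
  qed
  obtain k where "t / x < 2 ^ k" using real_arch_pow[of 2 "t / x"] by auto
  then have "t \<le> 2 ^ Suc k * x" using X by (auto simp: field_simps)
  then show ?thesis using gen X by blast
qed

text \<open>
  A lower Potter bound for the regularly varying function \<open>a powr F / v\<close> of positive index
  \<open>A * F - V\<close>. The quotient need not be monotone, but monotonicity of \<open>a\<close> and \<open>v\<close> separately
  controls it between consecutive doublings. With \<open>a = v\<close> and \<open>F = 2\<close> the quotient is \<open>v\<close> itself.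
\<close>
lemma quotient_power_growth:
  assumes a: "regular_scale a A" and v: "regular_scale v V" and F: "V < A * F"
  shows "\<exists>X C \<beta>. 0 < X \<and> 0 < C \<and> 0 < \<beta> \<and>
    (\<forall>x\<ge>X. \<forall>t\<ge>x. C * (t / x) powr \<beta> * (a x powr F / v x) \<le> a t powr F / v t)"
proof -
  interpret a: regular_scale a A by fact
  interpret v: regular_scale v V by fact
  have F0: "0 < F"
  proof -
    have "0 < A * F" using F v.index_pos by linarith
    then show ?thesis using a.index_pos by (rule zero_less_mult_pos)
  qed
  \<comment> \<open>Of the index \<open>4 * \<eta>\<close>, the amount \<open>\<eta>\<close> is given away for \<open>a\<close> and again for \<open>v\<close>.\<close>
  define \<eta> where "\<eta> = (A * F - V) / 4"
  define r where "r = 2 powr (V + \<eta>)"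
  have \<eta>: "0 < \<eta>" using F by (simp add: \<eta>_def)
  have "\<forall>\<^sub>F y in at_top. 2 powr (A - \<eta> / F) * a y \<le> a (2 * y)"
    using F0 \<eta> by (intro a.eventually_ge) auto
  moreover have "\<forall>\<^sub>F y in at_top. v (2 * y) \<le> r * v y"
    using F0 \<eta> by (intro v.eventually_le) (auto simp: r_def)
  ultimately have "\<forall>\<^sub>F y in at_top. 2 powr (A - \<eta> / F) * a y \<le> a (2 * y) \<and> v (2 * y) \<le> r * v y"
    by (rule eventually_conj)
  then obtain X0 where X0: "\<And>y. X0 \<le> y \<Longrightarrow> 2 powr (A - \<eta> / F) * a y \<le> a (2 * y) \<and> v (2 * y) \<le> r * v y"
    by (auto simp: eventually_at_top_linorder)
  define X where "X = max X0 1"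
  define g where "g = (\<lambda>y. a y powr F / v y)"
  have X: "0 < X" by (simp add: X_def)
  have av: "0 < a y" "0 < v y" if "X \<le> y" for y using that a.pos v.pos X by auto
  have double: "2 powr (2 * \<eta>) * g y \<le> g (2 * y)" if y: "X \<le> y" for y
  proof -
    have 1: "2 powr (A - \<eta> / F) * a y \<le> a (2 * y)" "v (2 * y) \<le> r * v y"
      using X0 y by (auto simp: X_def)
    have e: "(A - \<eta> / F) * F = 2 * \<eta> + (V + \<eta>)"
      using F0 by (simp add: \<eta>_def field_simps)
    have "(2 powr (A - \<eta> / F)) powr F = 2 powr (2 * \<eta>) * r"
      unfolding r_def powr_powr e by (rule powr_add)
    then have "2 powr (2 * \<eta>) * g y = (2 powr (A - \<eta> / F) * a y) powr F / (r * v y)"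
      using av[OF y] by (simp add: g_def powr_mult r_def)
    also have "\<dots> \<le> a (2 * y) powr F / v (2 * y)"
      using 1 F0 av[OF y] av[of "2 * y"] y X by (intro frac_le powr_mono2) auto
    finally show ?thesis by (simp add: g_def)
  qed
  have short: "1 / r * g y \<le> g s" if y: "X \<le> y" "y \<le> s" "s \<le> 2 * y" for y s
  proof -
    have "v s \<le> v (2 * y)" using v.mono y X by auto
    also have "\<dots> \<le> r * v y" using X0 y by (auto simp: X_def)
    finally have "a y powr F / (r * v y) \<le> a s powr F / v s"
      using y X F0 av[of y] av[of s] a.mono[of y s] by (intro frac_le powr_mono2) auto
    then show ?thesis by (simp add: g_def)
  qed
  have "(1 / r / 2 powr (2 * \<eta>)) * (t / x) powr (2 * \<eta>) * g x \<le> g t" if "X \<le> x" "x \<le> t" for x t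
  proof -
    have "1 / r * (t / (2 * x)) powr (2 * \<eta>) * g x \<le> g t"
      by (rule doubling_imp_power_growth[where X = X])
         (use that X \<eta> double short av in \<open>auto simp: r_def g_def less_imp_le\<close>)
    also have "(t / (2 * x)) powr (2 * \<eta>) = (t / x) powr (2 * \<eta>) / 2 powr (2 * \<eta>)"
      using that X by (subst powr_divide [symmetric]) (auto simp: mult.commute)
    finally show ?thesis by simp
  qed
  moreover have "0 < 1 / r / 2 powr (2 * \<eta>)" "0 < 2 * \<eta>" using \<eta> by (simp_all add: r_def)
  ultimately show ?thesis unfolding g_def using X by blast
qed

context regular_scale
begin

lemma ge_power:
  "\<exists>C \<beta>. 0 < C \<and> 0 < \<beta> \<and> (\<forall>\<^sub>F t in at_top. C * t powr \<beta> \<le> f t)"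
proof -
  obtain X C \<beta> where X: "0 < X" "0 < C" "0 < \<beta>"
    and *: "\<And>x t. X \<le> x \<Longrightarrow> x \<le> t \<Longrightarrow> C * (t / x) powr \<beta> * (f x powr 2 / f x) \<le> f t powr 2 / f t"
  proof -
    have "\<rho> < \<rho> * 2" using index_pos by simp
    from quotient_power_growth[OF regular_scale_axioms regular_scale_axioms this]
    show thesis using that by blast
  qed
  have sq: "f x powr 2 / f x = f x" if "0 \<le> x" for x
    using pos[OF that] by (simp add: powr_numeral power2_eq_square)
  have "C / X powr \<beta> * f X * t powr \<beta> \<le> f t" if "X \<le> t" for t
    using *[of X t] that X by (simp add: sq powr_divide mult_ac)
  then have "\<forall>\<^sub>F t in at_top. C / X powr \<beta> * f X * t powr \<beta> \<le> f t"
    by (auto simp: eventually_at_top_linorder)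
  then show ?thesis using X pos[of X] by (intro exI[of _ "C / X powr \<beta> * f X"] exI[of _ \<beta>]) auto
qed

lemma at_top: "filterlim f at_top at_top"
proof -
  obtain C \<beta> where C: "0 < C" "0 < \<beta>" "\<forall>\<^sub>F t in at_top. C * t powr \<beta> \<le> f t"
    using ge_power by blast
  have "filterlim (\<lambda>t. C * t powr \<beta>) at_top at_top" using C by real_asymp
  then show ?thesis using C(3) by (rule filterlim_at_top_mono)
qed

lemma ln_over_tendsto_0:
  assumes "0 < L" "0 \<le> S"
  shows "((\<lambda>t. ln (L * t + 1 + S) / f t) \<longlongrightarrow> 0) at_top"
proof -
  obtain C \<beta> where C: "0 < C" "0 < \<beta>" "\<forall>\<^sub>F t in at_top. C * t powr \<beta> \<le> f t"
    using ge_power by blast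
  show ?thesis
  proof (rule tendsto_sandwich)
    show "\<forall>\<^sub>F t in at_top. 0 \<le> ln (L * t + 1 + S) / f t"
      using eventually_gt_at_top[of 0]
      by eventually_elim (use assms in \<open>auto intro!: divide_nonneg_pos pos\<close>)
    show "\<forall>\<^sub>F t in at_top. ln (L * t + 1 + S) / f t \<le> ln (L * t + 1 + S) / (C * t powr \<beta>)"
      using C(3) eventually_gt_at_top[of 0]
      by eventually_elim (use assms C in \<open>auto intro!: divide_left_mono mult_pos_pos pos\<close>)
    show "((\<lambda>t. ln (L * t + 1 + S) / (C * t powr \<beta>)) \<longlongrightarrow> 0) at_top"
      using C assms by real_asymp
  qed simp
qed

text \<open>
  Positivity of the index is enough: \<open>f\<close> dominates some power of \<open>t\<close>, and any stretched exponential
  is summable.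
\<close>
lemma summable_exp_minus:
  assumes "0 < k"
  shows "summable (\<lambda>n. exp (- k * f (real n)))"
proof -
  obtain C \<beta> where C: "0 < C" "0 < \<beta>" "\<forall>\<^sub>F t in at_top. C * t powr \<beta> \<le> f t"
    using ge_power by blast
  have 1: "\<forall>\<^sub>F t::real in at_top. exp (- k * (C * t powr \<beta>)) \<le> 1 / t ^ 2"
    using C assms by real_asymp
  have "\<forall>\<^sub>F t in at_top. norm (exp (- k * f t)) \<le> 1 / t ^ 2"
    using C(3) 1
  proof eventually_elim
    case (elim t)
    have "exp (- k * f t) \<le> exp (- k * (C * t powr \<beta>))" using elim assms by simp
    with elim(2) show ?case by (smt (verit) abs_exp_cancel real_norm_def)
  qed
  then have "\<forall>\<^sub>F n in sequentially. norm (exp (- k * f (real n))) \<le> 1 / real n ^ 2"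
    using filterlim_real_sequentially by (auto simp: filterlim_iff)
  moreover have "summable (\<lambda>n. 1 / real n ^ 2)"
    using inverse_power_summable[of 2, where 'a = real] by (simp add: inverse_eq_divide)
  ultimately show ?thesis by (rule summable_comparison_test_ev)
qed

end

section \<open>Normalized logarithms of probabilities\<close>

text \<open>
  These two equivalences translate between extended-real rates and exponential bounds. They hold
  also for \<open>p = 0\<close>, where the normalized logarithm is \<open>-\<infinity>\<close>.
\<close>
lemma normalized_elog_le_iff:
  assumes "0 < s" "0 \<le> p"
  shows "ereal (1 / s) * elog p \<le> ereal (- x) \<longleftrightarrow> p \<le> exp (- (s * x))"
proof (cases "p = 0")
  case False
  then have "ln p / s \<le> - x \<longleftrightarrow> ln p \<le> - (s * x)" using assms by (simp add: field_simps)
  also have "\<dots> \<longleftrightarrow> p \<le> exp (- (s * x))"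
    using False assms exp_le_cancel_iff[of "ln p"] by simp
  finally show ?thesis using False by (simp add: elog_def)
qed (use assms in \<open>simp add: elog_def\<close>)

lemma le_normalized_elog_iff:
  assumes "0 < s" "0 \<le> p"
  shows "ereal (- x) \<le> ereal (1 / s) * elog p \<longleftrightarrow> exp (- (s * x)) \<le> p"
proof (cases "p = 0")
  case False
  then have "- x \<le> ln p / s \<longleftrightarrow> - (s * x) \<le> ln p" using assms by (simp add: field_simps)
  also have "\<dots> \<longleftrightarrow> exp (- (s * x)) \<le> p"
    using False assms by (subst ln_ge_iff) auto
  finally show ?thesis using False by (simp add: elog_def)
qed (use assms in \<open>simp add: elog_def\<close>)

section \<open>Exceedance probabilities along one direction\<close>

text \<open>
  What remains of the random vectors after a direction \<open>q\<close> is fixed: \<open>p n u\<close> stands for the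
  probability of \<open>W n > u q\<close>, and \<open>j c\<close> for the rate at \<open>c q\<close>.
\<close>
locale rare_event = a: regular_scale a A + v: regular_scale v V
  for a v :: "real \<Rightarrow> real" and A V :: real +
  fixes p :: "nat \<Rightarrow> real \<Rightarrow> real" and j :: "real \<Rightarrow> ereal"
  assumes p_nonneg: "0 \<le> p n u"
    and p_antimono: "0 \<le> u \<Longrightarrow> u \<le> u' \<Longrightarrow> p n u' \<le> p n u"
    and rate: "0 \<le> c \<Longrightarrow>
      (\<lambda>n. ereal (1 / v (real n)) * elog (p n (c * a (real n)))) \<longlonglongrightarrow> - j c"
    and j_nonneg: "0 \<le> c \<Longrightarrow> 0 \<le> j c"
    and j_zero: "0 < j 0"
    and decay: "\<exists>F K. V / A < F \<and> 0 < K \<and>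
      (\<forall>n. \<forall>c>K. p n (c * a (real n)) \<le> exp (- (v (real n) * c powr F)))"
begin

lemma eventually_p_le:
  assumes "0 \<le> c" "ereal x < j c"
  shows "\<forall>\<^sub>F n in sequentially. p n (c * a (real n)) \<le> exp (- (v (real n) * x))"
proof -
  have "- j c < ereal (- x)" using assms(2) by (simp flip: uminus_ereal.simps(1))
  from order_tendstoD(2)[OF rate[OF assms(1)] this] show ?thesis
    by eventually_elim (use v.pos p_nonneg in \<open>auto simp flip: normalized_elog_le_iff\<close>)
qed

lemma eventually_le_p:
  assumes "0 \<le> c" "j c < ereal x"
  shows "\<forall>\<^sub>F n in sequentially. exp (- (v (real n) * x)) \<le> p n (c * a (real n))"
proof -
  have "ereal (- x) < - j c" using assms(2) by (simp add: ereal_less_uminus_reorder)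
  from order_tendstoD(1)[OF rate[OF assms(1)] this] show ?thesis
    by eventually_elim (use v.pos p_nonneg in \<open>auto simp flip: le_normalized_elog_iff\<close>)
qed

text \<open>
  The time is \<open>n\<close> close to \<open>t / c powr (1 / A)\<close>, where \<open>a n\<close> is about \<open>a t / c\<close>. Rounding up and a factor
  \<open>r > 1\<close> ensure \<open>a t \<le> c * a n\<close>, and \<open>r\<close> is chosen so close to \<open>1\<close> that the resulting increase of \<open>v n\<close>
  uses up no more than the gap between \<open>z\<close> and the rate.
\<close>
lemma single_time_lower_bound:
  assumes c: "0 < c" and z: "ereal (c powr (- (V / A))) * j c < ereal z"
  shows "\<forall>\<^sub>F t in at_top. \<exists>n. exp (- (v t * z)) \<le> p n (a t)"
proof -
  have cpos: "0 < c powr (- (V / A))" using c by simp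
  have A: "0 < A" and V: "0 < V" using a.index_pos v.index_pos .
  have "j c \<noteq> \<infinity>" using z cpos by auto
  with j_nonneg[of c] c obtain j0 where j0: "j c = ereal j0" "0 \<le> j0"
    by (cases "j c") auto
  have "c powr (- (V / A)) * j0 < z" using z by (simp add: j0)
  then have "j0 < z / c powr (- (V / A))" using cpos by (simp add: field_simps)
  then obtain x where x: "j0 < x" "x < z / c powr (- (V / A))" using dense by blast
  have xz: "0 < x" "c powr (- (V / A)) * x < z" using x j0 cpos by (auto simp: field_simps)
  \<comment> \<open>The gap is \<open>r powr (3 * V)\<close>: one factor \<open>r\<close> moves \<open>n\<close> beyond \<open>t / c powr (1 / A)\<close>, one pays for
    rounding, and one turns the asymptotic equivalence for \<open>v\<close> into an inequality.\<close>
  define r where "r = (z / (c powr (- (V / A)) * x)) powr (1 / (3 * V))"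
  have r: "1 < r" using xz cpos V by (auto simp: r_def intro!: gr_one_powr)
  have zpos: "0 < z" using mult_pos_pos[OF cpos xz(1)] xz(2) by linarith
  have r3: "r powr (3 * V) = z / (c powr (- (V / A)) * x)"
    using xz zpos cpos V by (simp add: r_def powr_powr)
  define b where "b = r / c powr (1 / A)"
  have b: "0 < b" using r c by (simp add: b_def)
  have "b powr A = r powr A * inverse c"
    using r c A by (simp add: b_def powr_divide powr_powr inverse_eq_divide)
  also have "\<dots> > 1 * inverse c" using r c A by (intro mult_strict_right_mono) (auto intro!: gr_one_powr)
  finally have "\<forall>\<^sub>F t in at_top. 1 / c * a t \<le> a (b * t)"
    by (intro a.eventually_ge b) (simp add: inverse_eq_divide)
  moreover have "(r * b) powr V < z / x"
  proof -
    have "r * b = r powr 2 / c powr (1 / A)"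
      using r by (simp add: b_def powr_numeral power2_eq_square)
    then have "(r * b) powr V = r powr (2 * V) * c powr (- (V / A))"
      using r c by (simp add: powr_divide powr_powr powr_minus_divide del: powr_numeral)
    also have "\<dots> < r powr (3 * V) * c powr (- (V / A))"
      using r V cpos by (intro mult_strict_right_mono powr_less_mono) auto
    also have "\<dots> = z / x" using r3 cpos by simp
    finally show ?thesis .
  qed
  then have "\<forall>\<^sub>F t in at_top. v ((r * b) * t) \<le> z / x * v t"
    using r b by (intro v.eventually_le) auto
  moreover have "\<forall>\<^sub>F t in at_top. b * t + 1 \<le> r * b * t"
    using r b by real_asymp
  moreover have "\<forall>\<^sub>F t in at_top. exp (- (v (real (nat \<lceil>b * t\<rceil>)) * x)) \<le> p (nat \<lceil>b * t\<rceil>) (c * a (real (nat \<lceil>b * t\<rceil>)))"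
  proof -
    have "filterlim (\<lambda>t. nat \<lceil>b * t\<rceil>) sequentially at_top" using b by real_asymp
    moreover have "\<forall>\<^sub>F n in sequentially. exp (- (v (real n) * x)) \<le> p n (c * a (real n))"
      using c x by (intro eventually_le_p) (auto simp: j0)
    ultimately show ?thesis by (rule eventually_compose_filterlim[rotated])
  qed
  ultimately show ?thesis using eventually_ge_at_top[of 0]
  proof eventually_elim
    case (elim t)
    define n where "n = nat \<lceil>b * t\<rceil>"
    have n: "b * t \<le> real n" "real n \<le> b * t + 1" using elim b by (auto simp: n_def)
    have bt: "0 \<le> b * t" using elim b by simp
    have "a t / c \<le> a (real n)" using elim(1) a.mono[OF bt n(1)] by simp
    then have "a t \<le> c * a (real n)" using c by (simp add: field_simps)
    then have 1: "p n (c * a (real n)) \<le> p n (a t)" using a.pos[of t] elim by (intro p_antimono) auto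
    have "v (real n) \<le> v (r * b * t)" using n elim bt by (intro v.mono) auto
    then have "v (real n) * x \<le> z / x * v t * x" using elim xz by (intro mult_right_mono) auto
    then have "exp (- (v t * z)) \<le> exp (- (v (real n) * x))" using xz by (simp add: mult_ac)
    also have "\<dots> \<le> p n (c * a (real n))" using elim by (simp add: n_def)
    also note 1
    finally show ?case by blast
  qed
qed

text \<open>
  The decay hypothesis at \<open>c = a t / a n\<close> gives the exponent \<open>v n * c powr F = v t * (g t / g n)\<close> with
  \<open>g = a powr F / v\<close>. The growth of \<open>g\<close> makes \<open>g t / g n\<close> at least \<open>m\<close> when \<open>n \<le> \<delta> t\<close>; the finitely many
  \<open>n\<close> below the range of the growth bound are absorbed because \<open>g t\<close> tends to infinity.
\<close>
lemma early_times:
  assumes m: "0 < m"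
  shows "\<exists>\<delta>>0. \<forall>\<^sub>F t in at_top. \<forall>n. real n \<le> \<delta> * t \<longrightarrow> p n (a t) \<le> exp (- (v t * m))"
proof -
  have A: "0 < A" and V: "0 < V" using a.index_pos v.index_pos .
  obtain F K where F: "V / A < F" and K: "0 < K"
    and dec: "\<And>n c. K < c \<Longrightarrow> p n (c * a (real n)) \<le> exp (- (v (real n) * c powr F))"
    using decay by blast
  have AF: "V < A * F" using F A by (simp add: field_simps)
  have F0: "0 < F" using A V by (intro less_trans[OF _ F]) simp
  define g where "g x = a x powr F / v x" for x
  have g_pos: "0 < g x" if "0 \<le> x" for x using a.pos[OF that] v.pos[OF that] by (simp add: g_def)
  obtain X C \<beta> where X: "0 < X" and C: "0 < C" and \<beta>: "0 < \<beta>"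
    and grow: "\<And>x t. X \<le> x \<Longrightarrow> x \<le> t \<Longrightarrow> C * (t / x) powr \<beta> * g x \<le> g t"
    using quotient_power_growth[OF a.regular_scale_axioms v.regular_scale_axioms AF]
    unfolding g_def by blast
  have ratio: "p n (a t) \<le> exp (- (v t * m))"
    if "0 \<le> t" "m * g (real n) \<le> g t" "K * a (real n) < a t" for n t
  proof -
    have pos: "0 < a t" "0 < v t" "0 < a (real n)" "0 < v (real n)"
      using that(1) a.pos v.pos by auto
    have "p n (a t / a (real n) * a (real n)) \<le> exp (- (v (real n) * (a t / a (real n)) powr F))"
      using that(3) pos by (intro dec) (simp add: field_simps)
    then have "p n (a t) \<le> exp (- (v (real n) * (a t / a (real n)) powr F))" using pos by simp
    also have "v (real n) * (a t / a (real n)) powr F = v t * (g t / g (real n))"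
      using pos by (simp add: g_def powr_divide)
    also have "exp (- (v t * (g t / g (real n)))) \<le> exp (- (v t * m))"
      using that(2) pos g_pos[of "real n"] by (auto simp: field_simps)
    finally show ?thesis .
  qed
  \<comment> \<open>The last condition puts \<open>a t / a n\<close> beyond the threshold \<open>K\<close> for all \<open>n \<le> \<delta> t\<close>.\<close>
  obtain \<delta> where \<delta>: "0 < \<delta>" "\<delta> \<le> 1" "m \<le> C * (1 / \<delta>) powr \<beta>" "\<delta> powr A < 1 / K"
  proof -
    have "\<forall>\<^sub>F d in at_right (0::real). 0 < d \<and> d \<le> 1"
      by (rule eventually_at_rightI[of 0 1]) auto
    moreover have "\<forall>\<^sub>F d in at_right 0. m \<le> C * (1 / d) powr \<beta>" using C \<beta> by real_asymp
    moreover have "\<forall>\<^sub>F d in at_right 0. d powr A < 1 / K" using K A by real_asymp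
    ultimately have "\<forall>\<^sub>F d in at_right 0. (0 < d \<and> d \<le> 1) \<and> m \<le> C * (1 / d) powr \<beta> \<and> d powr A < 1 / K"
      by eventually_elim auto
    from eventually_happens'[OF trivial_limit_at_right_real this] show thesis
      using that by blast
  qed
  have "finite {n. real n < X}"
    by (rule finite_subset[of _ "{..nat \<lceil>X\<rceil>}"]) (auto simp: nat_le_iff, linarith)
  define G where "G = (\<Sum>n | real n < X. g (real n))"
  have G: "g (real n) \<le> G" if "real n < X" for n
    unfolding G_def using that \<open>finite {n. real n < X}\<close> g_pos
    by (intro member_le_sum) (auto intro: less_imp_le)
  have "\<forall>\<^sub>F t in at_top. m * G \<le> C * (t / X) powr \<beta> * g X"
    using C \<beta> X g_pos[of X] by real_asymp
  moreover have "\<forall>\<^sub>F t in at_top. a (\<delta> * t) \<le> (\<delta> powr A + 1 / K) / 2 * a t"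
    using \<delta> by (intro a.eventually_le) (auto simp: field_simps)
  ultimately have "\<forall>\<^sub>F t in at_top. \<forall>n. real n \<le> \<delta> * t \<longrightarrow> p n (a t) \<le> exp (- (v t * m))"
    using eventually_ge_at_top[of X]
  proof eventually_elim
    case (elim t)
    show ?case
    proof (intro allI impI ratio)
      fix n assume n: "real n \<le> \<delta> * t"
      show "0 \<le> t" using elim X by simp
      have "a (real n) \<le> a (\<delta> * t)" using n by (intro a.mono) auto
      also note elim(2)
      also have "(\<delta> powr A + 1 / K) / 2 * a t < 1 / K * a t"
        using \<delta> a.pos[OF \<open>0 \<le> t\<close>] by (intro mult_strict_right_mono) auto
      finally show "K * a (real n) < a t" using K by (simp add: field_simps)
      show "m * g (real n) \<le> g t"
      proof (cases "real n < X")
        case True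
        have "m * g (real n) \<le> m * G" using m G[OF True] by simp
        also have "\<dots> \<le> g t" using elim grow[of X t] by simp
        finally show ?thesis .
      next
        case False
        have nt: "real n \<le> t" using n \<delta> \<open>0 \<le> t\<close> mult_right_mono[of \<delta> 1 t] by simp
        have "1 / \<delta> \<le> t / real n" using n \<delta> X False by (simp add: field_simps)
        then have "C * (1 / \<delta>) powr \<beta> \<le> C * (t / real n) powr \<beta>"
          using C \<beta> \<delta> by (intro mult_left_mono powr_mono2) auto
        then have "m * g (real n) \<le> C * (t / real n) powr \<beta> * g (real n)"
          using \<delta> g_pos[of "real n"] by (intro mult_right_mono) auto
        also have "\<dots> \<le> g t" using False nt by (intro grow) auto
        finally show ?thesis .
      qed
    qed
  qed
  with \<delta>(1) show ?thesis by blast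
qed

text \<open>
  For \<open>n / t\<close> in a small window around \<open>s\<close>, the threshold \<open>a t\<close> is at least \<open>a n / \<kappa>\<close> for a constant \<open>\<kappa>\<close> slightly
  above \<open>s powr A\<close>, so the limit at the one point \<open>1 / \<kappa>\<close> bounds all these probabilities. The
  loss incurred is a power of the width of the window and fits between \<open>m\<close> and a number \<open>m'\<close> that is
  still below the infimum. Bisection of the compact interval \<open>{\<delta>..L}\<close> patches the windows
  together.
\<close>
lemma comparable_times:
  assumes m: "0 < m" and inf: "ereal m < (INF c\<in>{0<..}. ereal (c powr (- (V / A))) * j c)"
    and \<delta>: "0 < \<delta>" "\<delta> \<le> L"
  shows "\<forall>\<^sub>F t in at_top. \<forall>n. \<delta> * t \<le> real n \<and> real n \<le> L * t \<longrightarrow> p n (a t) \<le> exp (- (v t * m))"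
    (is "?P \<delta> L")
proof -
  have A: "0 < A" and V: "0 < V" using a.index_pos v.index_pos .
  obtain m' where m': "m < m'"
    "ereal m' < (INF c\<in>{0<..}. ereal (c powr (- (V / A))) * j c)"
    using ereal_dense2[OF inf] by auto
  have j_gt: "ereal (c powr (V / A) * m') < j c" if "0 < c" for c
  proof -
    have "(INF c\<in>{0<..}. ereal (c powr (- (V / A))) * j c) \<le> ereal (c powr (- (V / A))) * j c"
      using that by (intro INF_lower) simp
    with m'(2) have "ereal m' < ereal (c powr (- (V / A))) * j c" by (rule less_le_trans)
    then show ?thesis using that j_nonneg[of c]
      by (cases "j c") (auto simp: powr_minus field_simps)
  qed
  define r where "r = (m' / m) powr (1 / (4 * V))"
  have r: "1 < r" using m m' V by (auto simp: r_def intro!: gr_one_powr)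
  have r4: "r powr (4 * V) = m' / m" using m m' V by (simp add: r_def powr_powr)
  have window: "?P (s / r) (s * r)" if s: "0 < s" for s
  proof -
    \<comment> \<open>The window extends by the factor \<open>r\<close> on either side of \<open>s\<close>; the exponent \<open>2\<close> leaves room to pass from limits to
      inequalities, and the total loss \<open>r powr (4 * V)\<close> is exactly \<open>m' / m\<close>.\<close>
    define \<kappa> where "\<kappa> = (s * r\<^sup>2) powr A"
    define \<theta> where "\<theta> = (s / r\<^sup>2) powr V"
    have rr: "r < r\<^sup>2" using r by (simp add: power2_eq_square)
    have \<kappa>: "0 < \<kappa>" using s r by (auto simp: \<kappa>_def)
    have m_eq: "m = \<theta> * ((1 / \<kappa>) powr (V / A) * m')"
    proof -
      have "(1 / \<kappa>) powr (V / A) = 1 / (s * r\<^sup>2) powr V"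
        using s r A by (simp add: \<kappa>_def powr_divide powr_powr)
      moreover have "r\<^sup>2 powr V * r\<^sup>2 powr V = m' / m"
        using r r4 by (simp add: powr_powr flip: powr_numeral powr_add)
      ultimately show ?thesis
        using s r m m' by (simp add: \<theta>_def powr_divide powr_mult field_simps)
    qed
    have "\<forall>\<^sub>F t in at_top. a (s * r * t) \<le> \<kappa> * a t"
      using s r rr A unfolding \<kappa>_def by (intro a.eventually_le powr_less_mono2) auto
    moreover have "\<forall>\<^sub>F t in at_top. \<theta> * v t \<le> v (s / r * t)"
      using s r rr V unfolding \<theta>_def by (intro v.eventually_ge powr_less_mono2) (auto intro!: divide_strict_left_mono)
    moreover have "\<forall>\<^sub>F t in at_top. \<forall>n. s / r * t \<le> real n \<longrightarrow>
        p n (1 / \<kappa> * a (real n)) \<le> exp (- (v (real n) * ((1 / \<kappa>) powr (V / A) * m')))"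
    proof -
      have "0 < 1 / \<kappa>" using \<kappa> by simp
      from eventually_p_le[OF less_imp_le[OF this] j_gt[OF this]] obtain N where
        N: "\<And>n. N \<le> n \<Longrightarrow> p n (1 / \<kappa> * a (real n)) \<le> exp (- (v (real n) * ((1 / \<kappa>) powr (V / A) * m')))"
        by (auto simp: eventually_sequentially)
      have "\<forall>\<^sub>F t in at_top. real N \<le> s / r * t" using s r by real_asymp
      then show ?thesis by eventually_elim (use N in force)
    qed
    ultimately show ?thesis using eventually_ge_at_top[of 0]
    proof eventually_elim
      case (elim t)
      show ?case
      proof (intro allI impI)
        fix n assume n: "s / r * t \<le> real n \<and> real n \<le> s * r * t"
        have "a (real n) \<le> \<kappa> * a t" using n elim(1) a.mono[of "real n" "s * r * t"] by auto
        then have "p n (a t) \<le> p n (1 / \<kappa> * a (real n))"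
          using \<kappa> a.pos[of "real n"] by (intro p_antimono) (auto simp: field_simps)
        also have "\<dots> \<le> exp (- (v (real n) * ((1 / \<kappa>) powr (V / A) * m')))" using elim n by blast
        also have "\<theta> * v t \<le> v (real n)"
          using elim n s r v.mono[of "s / r * t" "real n"] by auto
        then have "exp (- (v (real n) * ((1 / \<kappa>) powr (V / A) * m'))) \<le> exp (- (v t * m))"
          using m m' mult_right_mono[of "\<theta> * v t" "v (real n)" "(1 / \<kappa>) powr (V / A) * m'"]
          by (subst m_eq) (simp add: mult_ac)
        finally show "p n (a t) \<le> exp (- (v t * m))" .
      qed
    qed
  qed
  show ?thesis using \<delta>(2)
  proof (induction rule: Bolzano)
    case (trans x y z)
    from trans(1,2) show ?case by eventually_elim (meson linear)
  next
    case (local s)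
    then have s: "0 < s" using \<delta> by simp
    define d where "d = min (s - s / r) (s * r - s)"
    have "?P x y" if "x \<le> s" "s \<le> y" "y - x < d" for x y
    proof -
      have xy: "s / r \<le> x" "y \<le> s * r" using that by (auto simp: d_def)
      from window[OF s] eventually_ge_at_top[of 0] show ?thesis
      proof eventually_elim
        case (elim t)
        have "s / r * t \<le> x * t" "y * t \<le> s * r * t"
          using mult_right_mono[OF xy(1) elim(2)] mult_right_mono[OF xy(2) elim(2)] by auto
        then show ?case using elim(1) by (meson order_trans)
      qed
    qed
    moreover have "0 < d" using s r by (auto simp: d_def field_simps)
    ultimately show ?case by blast
  qed
qed

text \<open>
  The crude bound by the probability of \<open>W n > 0\<close> has an exponent \<open>2 * k * v n\<close>. For \<open>n \<ge> L t\<close> one half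
  of it dominates \<open>m * v t\<close>, and the other half is kept for summability.
\<close>
lemma late_times:
  assumes m: "0 < m"
  shows "\<exists>L k. 0 < L \<and> 0 < k \<and> (\<forall>\<^sub>F t in at_top. \<forall>n. L * t \<le> real n \<longrightarrow>
    p n (a t) \<le> exp (- (v t * m)) * exp (- k * v (real n)))"
proof -
  have V: "0 < V" using v.index_pos .
  obtain k where k: "0 < k" "ereal (2 * k) < j 0"
  proof -
    obtain y where "0 < y" "ereal y < j 0" using ereal_dense2[OF j_zero] by auto
    then show thesis using that[of "y / 2"] by simp
  qed
  \<comment> \<open>Twice the required \<open>m / k\<close>, so that the limit relation becomes an inequality.\<close>
  define L where "L = (2 * m / k) powr (1 / V)"
  have L: "0 < L" "L powr V = 2 * m / k" using m k V by (auto simp: L_def powr_powr)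
  have "\<forall>\<^sub>F t in at_top. m / k * v t \<le> v (L * t)"
    using L m k by (intro v.eventually_ge) (auto simp: field_simps)
  moreover have "\<forall>\<^sub>F t in at_top. \<forall>n. L * t \<le> real n \<longrightarrow> p n (0 * a (real n)) \<le> exp (- (v (real n) * (2 * k)))"
  proof -
    from eventually_p_le[OF order_refl k(2)] obtain N where
      N: "\<And>n. N \<le> n \<Longrightarrow> p n (0 * a (real n)) \<le> exp (- (v (real n) * (2 * k)))"
      by (auto simp: eventually_sequentially)
    have "\<forall>\<^sub>F t in at_top. real N \<le> L * t" using L(1) by real_asymp
    then show ?thesis by eventually_elim (use N in force)
  qed
  ultimately have "\<forall>\<^sub>F t in at_top. \<forall>n. L * t \<le> real n \<longrightarrow>
    p n (a t) \<le> exp (- (v t * m)) * exp (- k * v (real n))"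
    using eventually_ge_at_top[of 0]
  proof eventually_elim
    case (elim t)
    show ?case
    proof (intro allI impI)
      fix n assume n: "L * t \<le> real n"
      have "m / k * v t \<le> v (real n)" using elim n L v.mono[of "L * t" "real n"] by auto
      then have mk: "v t * m \<le> k * v (real n)" using k by (simp add: field_simps)
      have "p n (a t) \<le> p n (0 * a (real n))" using a.pos[of t] elim by (intro p_antimono) auto
      also have "\<dots> \<le> exp (- (v (real n) * (2 * k)))" using elim n by blast
      also have "\<dots> \<le> exp (- (v t * m)) * exp (- k * v (real n))"
        using mk by (simp flip: exp_add)
      finally show "p n (a t) \<le> exp (- (v t * m)) * exp (- k * v (real n))" .
    qed
  qed
  with L k show ?thesis by blast
qed

lemma union_bound:
  assumes m: "0 < m" and inf: "ereal m < (INF c\<in>{0<..}. ereal (c powr (- (V / A))) * j c)"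
  shows "\<exists>L S. 0 < L \<and> 0 \<le> S \<and> (\<forall>\<^sub>F t in at_top. summable (\<lambda>n. p n (a t)) \<and>
    (\<Sum>n. p n (a t)) \<le> (L * t + 1 + S) * exp (- (v t * m)))"
proof -
  obtain \<delta> where \<delta>: "0 < \<delta>"
    and early: "\<forall>\<^sub>F t in at_top. \<forall>n. real n \<le> \<delta> * t \<longrightarrow> p n (a t) \<le> exp (- (v t * m))"
    using early_times[OF m] by blast
  obtain L k where L: "0 < L" and k: "0 < k"
    and late: "\<forall>\<^sub>F t in at_top. \<forall>n. L * t \<le> real n \<longrightarrow>
      p n (a t) \<le> exp (- (v t * m)) * exp (- k * v (real n))"
    using late_times[OF m] by blast
  \<comment> \<open>The minimum covers the case \<open>L < \<delta>\<close>, in which the first and last regimes overlap.\<close>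
  have mid: "\<forall>\<^sub>F t in at_top. \<forall>n. min \<delta> L * t \<le> real n \<and> real n \<le> L * t \<longrightarrow>
      p n (a t) \<le> exp (- (v t * m))"
    using \<delta> L by (intro comparable_times m inf) auto
  define S where "S = (\<Sum>n. exp (- k * v (real n)))"
  have sum: "summable (\<lambda>n. exp (- k * v (real n)))" by (rule v.summable_exp_minus[OF k])
  have S: "0 \<le> S" unfolding S_def by (intro suminf_nonneg sum) auto
  have "\<forall>\<^sub>F t in at_top. summable (\<lambda>n. p n (a t)) \<and>
    (\<Sum>n. p n (a t)) \<le> (L * t + 1 + S) * exp (- (v t * m))"
    using early mid late eventually_ge_at_top[of 0]
  proof eventually_elim
    case (elim t)
    define N where "N = nat \<lfloor>L * t\<rfloor>"
    define b where "b n = exp (- (v t * m)) * (of_bool (n \<in> {..N}) + exp (- k * v (real n)))" for n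
    have Lt: "0 \<le> L * t" using elim L by simp
    have p_le: "p n (a t) \<le> b n" for n
    proof (cases "real n \<le> L * t")
      case True
      then have "n \<in> {..N}" by (simp add: N_def le_nat_floor)
      moreover have "p n (a t) \<le> exp (- (v t * m)) * 1"
      proof (cases "real n \<le> \<delta> * t")
        case False
        then have "min \<delta> L * t \<le> real n"
          using mult_right_mono[of "min \<delta> L" \<delta> t] elim by auto
        then show ?thesis using elim True by simp
      qed (use elim in simp)
      ultimately show ?thesis
        unfolding b_def by (elim order_trans) (intro mult_left_mono, auto)
    next
      case False
      then have "p n (a t) \<le> exp (- (v t * m)) * exp (- k * v (real n))" using elim by auto
      then show ?thesis unfolding b_def
        by (rule order_trans) (intro mult_left_mono, auto)
    qed
    have "(\<lambda>n. of_bool (n \<in> {..N}) :: real) sums (\<Sum>n\<in>{..N}. 1)"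
      by (subst of_bool_def, rule sums_If_finite_set) simp
    then have "(\<lambda>n. of_bool (n \<in> {..N}) :: real) sums real (Suc N)" by simp
    then have b_sums: "b sums (exp (- (v t * m)) * (real (Suc N) + S))"
      unfolding b_def using sum unfolding S_def by (intro sums_mult sums_add summable_sums)
    have sp: "summable (\<lambda>n. p n (a t))"
      by (rule summable_comparison_test[of _ b]) (use p_le p_nonneg b_sums in \<open>auto simp: sums_iff\<close>)
    have "(\<Sum>n. p n (a t)) \<le> suminf b" using p_le sp b_sums by (intro suminf_le) (auto simp: sums_iff)
    also have "\<dots> = exp (- (v t * m)) * (real (Suc N) + S)" using b_sums by (simp add: sums_iff)
    also have "\<dots> \<le> exp (- (v t * m)) * (L * t + 1 + S)"
      using Lt by (intro mult_left_mono) (auto simp: N_def)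
    finally show ?case using sp by (simp add: mult.commute)
  qed
  with L S show ?thesis by blast
qed

text \<open>
  The probability \<open>P u\<close> of the union enters only through the bounds that a union always obeys: it
  is at most \<open>1\<close> and lies between each term and the sum.
\<close>
theorem union_decay:
  fixes P :: "real \<Rightarrow> real"
  assumes P1: "\<And>u. P u \<le> 1"
    and lower: "\<And>u n. p n u \<le> P u"
    and upper: "\<And>u. summable (\<lambda>n. p n u) \<Longrightarrow> P u \<le> (\<Sum>n. p n u)"
  shows "((\<lambda>t. ereal (1 / v t) * elog (P (a t))) \<longlongrightarrow>
    - (INF c\<in>{0<..}. ereal (c powr (- (V / A))) * j c)) at_top"
proof -
  define I where "I = (INF c\<in>{0<..}. ereal (c powr (- (V / A))) * j c)"
  have P0: "0 \<le> P u" for u using lower p_nonneg order_trans by blast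
  show ?thesis unfolding I_def[symmetric]
  proof (rule order_tendstoI)
    fix y assume "y < - I"
    then have "I < - y" by (simp add: ereal_less_uminus_reorder)
    then obtain c where c: "0 < c" "ereal (c powr (- (V / A))) * j c < - y"
      by (auto simp: I_def INF_less_iff)
    then obtain z where z: "ereal (c powr (- (V / A))) * j c < ereal z" "ereal z < - y"
      using ereal_dense2 by blast
    have y: "y < ereal (- z)" using z(2) by (simp add: ereal_less_uminus_reorder)
    show "\<forall>\<^sub>F t in at_top. y < ereal (1 / v t) * elog (P (a t))"
      using single_time_lower_bound[OF c(1) z(1)] eventually_ge_at_top[of 0]
    proof eventually_elim
      case (elim t)
      then have "exp (- (v t * z)) \<le> P (a t)" using lower order_trans by blast
      then have "ereal (- z) \<le> ereal (1 / v t) * elog (P (a t))"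
        using elim v.pos P0 by (subst le_normalized_elog_iff) auto
      with y show ?case by (rule less_le_trans)
    qed
  next
    fix y assume y: "- I < y"
    show "\<forall>\<^sub>F t in at_top. ereal (1 / v t) * elog (P (a t)) < y"
    \<comment> \<open>For \<open>y \<le> 0\<close> the infimum exceeds \<open>- y \<ge> 0\<close>, which leaves room for two positive reals
      \<open>m' < m\<close>; their difference absorbs the prefactor of the union bound.\<close>
    proof (cases "0 < y")
      case True
      show ?thesis using eventually_ge_at_top[of 0]
      proof eventually_elim
        case (elim t)
        have "ereal (1 / v t) * elog (P (a t)) \<le> ereal (- 0)"
          using elim v.pos P0 P1 by (subst normalized_elog_le_iff) auto
        with True show ?case by (simp add: zero_ereal_def)
      qed
    next
      case False
      then have y0: "0 \<le> - y" by (cases y) auto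
      have "- y < I" using y by (simp add: ereal_uminus_less_reorder)
      then obtain m' where m': "- y < ereal m'" "ereal m' < I" using ereal_dense2 by blast
      then obtain m where m: "ereal m' < ereal m" "ereal m < I" using ereal_dense2 by blast
      have "0 < m'" using le_less_trans[OF y0 m'(1)] by simp
      then have "0 < m" using m by simp
      then obtain L S where LS: "0 < L" "0 \<le> S" and
        bd: "\<forall>\<^sub>F t in at_top. summable (\<lambda>n. p n (a t)) \<and>
          (\<Sum>n. p n (a t)) \<le> (L * t + 1 + S) * exp (- (v t * m))"
        using union_bound[of m] m(2) unfolding I_def by blast
      have "\<forall>\<^sub>F t in at_top. ln (L * t + 1 + S) / v t < m - m'"
        using order_tendstoD(2)[OF v.ln_over_tendsto_0[OF LS], of "m - m'"] m(1) by simp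
      with bd show ?thesis using eventually_ge_at_top[of 0]
      proof eventually_elim
        case (elim t)
        have vt: "0 < v t" using elim v.pos by simp
        have q: "0 < L * t + 1 + S" using mult_nonneg_nonneg[of L t] elim LS by linarith
        have "P (a t) \<le> (L * t + 1 + S) * exp (- (v t * m))" using elim(1) upper order_trans by blast
        also have "\<dots> = exp (ln (L * t + 1 + S) - v t * m)" using q by (simp add: exp_diff exp_minus field_simps)
        also have "\<dots> \<le> exp (- (v t * m'))" using elim(2) vt by (simp add: field_simps)
        finally have "ereal (1 / v t) * elog (P (a t)) \<le> ereal (- m')"
          using vt P0 by (subst normalized_elog_le_iff) auto
        also have "ereal (- m') < y" using m'(1) by (cases y) auto
        finally show ?case .
      qed
    qed
  qed
qed

end

section \<open>Change of variables and conclusion\<close>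

text \<open>
  The range of \<open>f\<close> is all of \<open>{f 0..}\<close>, by continuity and divergence, so substituting \<open>t = f\<^sup>-\<^sup>1(u)\<close>
  transports limits along \<open>t\<close> to limits along \<open>u\<close>.
\<close>
lemma (in regular_scale) inv_into_regular_scale:
  assumes cont: "continuous_on {0..} f"
  shows "filterlim (inv_into {0..} f) at_top at_top"
    and "\<forall>\<^sub>F u in at_top. f (inv_into {0..} f u) = u"
proof -
  have range: "u \<in> f ` {0..}" if u: "f 0 \<le> u" for u
  proof -
    obtain t where t: "0 \<le> t" "u \<le> f t"
      using eventually_conj[OF eventually_ge_at_top[of 0] filterlim_at_top[THEN iffD1, OF at_top, rule_format, of u]]
      by (auto dest: eventually_happens)
    have "\<exists>x\<ge>0. x \<le> t \<and> f x = u"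
      using u t by (intro IVT') (auto intro: continuous_on_subset[OF cont])
    then show ?thesis by auto
  qed
  then have inv: "0 \<le> inv_into {0..} f u" "f (inv_into {0..} f u) = u" if "f 0 \<le> u" for u
    using that inv_into_into[of u f "{0..}"] f_inv_into_f[of u f "{0..}"] by auto
  show "\<forall>\<^sub>F u in at_top. f (inv_into {0..} f u) = u"
    using eventually_ge_at_top[of "f 0"] by eventually_elim (rule inv)
  show "filterlim (inv_into {0..} f) at_top at_top"
    unfolding filterlim_at_top
  proof
    fix T
    show "\<forall>\<^sub>F u in at_top. T \<le> inv_into {0..} f u"
      using eventually_ge_at_top[of "f 0"] eventually_gt_at_top[of "f T"]
    proof eventually_elim
      case (elim u)
      show ?case
      proof (rule ccontr)
        assume "\<not> T \<le> inv_into {0..} f u"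
        then have "f (inv_into {0..} f u) \<le> f T" using inv(1)[OF elim(1)] by (intro mono) auto
        with inv(2)[OF elim(1)] elim(2) show False by simp
      qed
    qed
  qed
qed

theorem theorem5:
  fixes M :: "'w measure"
    and a v :: "real \<Rightarrow> real"
    and A V :: real
    and W :: "nat \<Rightarrow> 'w \<Rightarrow> real ^ 'd"
    and J :: "real ^ 'd \<Rightarrow> ereal"
  assumes "prob_space M"
    and W_rv: "\<And>n. W n \<in> borel_measurable M"
    and a_pos: "\<And>t. 0 \<le> t \<Longrightarrow> 0 < a t"
    and a_cont: "continuous_on {0..} a"
    and a_mono: "strict_mono_on {0..} a"
    and A_pos: "0 < A"
    and a_rv: "regularly_varying a A"
    and v_pos: "\<And>t. 0 \<le> t \<Longrightarrow> 0 < v t"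
    and v_cont: "continuous_on {0..} v"
    and v_mono: "strict_mono_on {0..} v"
    and V_pos: "0 < V"
    and v_rv: "regularly_varying v V"
    and J_nonneg: "\<And>q. 0 \<le> q \<Longrightarrow> 0 \<le> J q"
    and ldp: "\<And>q. 0 \<le> q \<Longrightarrow>
      (\<lambda>n. ereal (1 / v (real n)) * elog \<P>(\<omega> in M. q <e W n \<omega> /\<^sub>R a (real n)))
        \<longlonglongrightarrow> - J q"
    and J_zero: "0 < J 0"
    and J_finite: "\<exists>y. 0 <e y \<and> J y < \<infinity>"
    and J_cont: "continuous_on (interior {x. 0 \<le> x \<and> J x < \<infinity>}) J"
    and decay: "\<And>q. 0 <e q \<Longrightarrow>
      \<exists>F K. V / A < F \<and> 0 < K \<and>
        (\<forall>n. \<forall>c>K. ereal (1 / v (real n)) *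
            elog \<P>(\<omega> in M. c *\<^sub>R q <e W n \<omega> /\<^sub>R a (real n)) \<le> ereal (- (c powr F)))"
  shows "\<forall>q. 0 <e q \<longrightarrow>
    ((\<lambda>u. ereal (1 / v (inv_into {0..} a u)) *
        elog \<P>(\<omega> in M. \<exists>n. u *\<^sub>R q <e W n \<omega>))
      \<longlongrightarrow> - (INF c\<in>{0<..}. ereal (c powr (- (V / A))) * J (c *\<^sub>R q))) at_top"
proof (intro allI impI)
  fix q :: "real ^ 'd" assume q: "0 <e q"
  interpret prob_space M by fact
  define E where "E n u = {\<omega> \<in> space M. u *\<^sub>R q <e W n \<omega>}" for n u
  define P where "P u = prob {\<omega> \<in> space M. \<exists>n. u *\<^sub>R q <e W n \<omega>}" for u
  have E_sets: "E n u \<in> sets M" for n u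
  proof -
    have "{x. u *\<^sub>R q <e x} \<in> sets borel" by (intro borel_open) auto
    from measurable_sets[OF W_rv[of n] this] show ?thesis
      by (simp add: E_def vimage_def Int_def conj_commute)
  qed
  have scale: "c *\<^sub>R q <e W n \<omega> /\<^sub>R a (real n) \<longleftrightarrow> (c * a (real n)) *\<^sub>R q <e W n \<omega>" for c n \<omega>
    using a_pos[of "real n"] by (auto simp: eucl_less_def field_simps)
  have scaled_prob: "\<P>(\<omega> in M. c *\<^sub>R q <e W n \<omega> /\<^sub>R a (real n)) = prob (E n (c * a (real n)))" for c n
    by (simp add: E_def scale)
  interpret rare_event a v A V "\<lambda>n u. prob (E n u)" "\<lambda>c. J (c *\<^sub>R q)"
  proof
    show "prob (E n u') \<le> prob (E n u)" if "0 \<le> u" "u \<le> u'" for n u u'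
    proof (rule finite_measure_mono[OF _ E_sets])
      have "u *\<^sub>R q \<bullet> i \<le> u' *\<^sub>R q \<bullet> i" if "i \<in> Basis" for i
        using q that \<open>u \<le> u'\<close> by (auto simp: eucl_less_def intro!: mult_right_mono less_imp_le)
      then show "E n u' \<subseteq> E n u"
        unfolding E_def eucl_less_def by (blast intro: le_less_trans)
    qed
    have cq: "0 \<le> c *\<^sub>R q" if "0 \<le> c" for c
      using q that by (auto simp: eucl_less_def eucl_le[where 'a="real ^ 'd"] intro!: mult_nonneg_nonneg intro: less_imp_le)
    show "(\<lambda>n. ereal (1 / v (real n)) * elog (prob (E n (c * a (real n))))) \<longlonglongrightarrow> - J (c *\<^sub>R q)"
      if "0 \<le> c" for c
      using ldp[OF cq[OF that]] by (simp add: scaled_prob)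
    show "0 \<le> J (c *\<^sub>R q)" if "0 \<le> c" for c using J_nonneg[OF cq[OF that]] .
    obtain F K where FK: "V / A < F" "0 < K" and d: "\<And>n c. K < c \<Longrightarrow>
        ereal (1 / v (real n)) * elog (prob (E n (c * a (real n)))) \<le> ereal (- (c powr F))"
      using decay[OF q] unfolding scaled_prob by blast
    have "prob (E n (c * a (real n))) \<le> exp (- (v (real n) * c powr F))" if "K < c" for n c
      using d[OF that, of n] v_pos[of "real n"] by (subst (asm) normalized_elog_le_iff) auto
    with FK show "\<exists>F K. V / A < F \<and> 0 < K \<and>
        (\<forall>n. \<forall>c>K. prob (E n (c * a (real n))) \<le> exp (- (v (real n) * c powr F)))" by blast
  qed (use assms in auto)
  have union: "{\<omega> \<in> space M. \<exists>n. u *\<^sub>R q <e W n \<omega>} = (\<Union>n. E n u)" for u by (auto simp: E_def)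
  have "((\<lambda>t. ereal (1 / v t) * elog (P (a t))) \<longlongrightarrow>
    - (INF c\<in>{0<..}. ereal (c powr (- (V / A))) * J (c *\<^sub>R q))) at_top"
  proof (rule union_decay)
    show "prob (E n u) \<le> P u" for u n
      unfolding P_def union using E_sets by (intro finite_measure_mono) auto
    show "P u \<le> (\<Sum>n. prob (E n u))" if "summable (\<lambda>n. prob (E n u))" for u
      unfolding P_def union using E_sets that by (intro finite_measure_subadditive_countably) auto
  qed (simp add: P_def)
  from filterlim_compose[OF this a.inv_into_regular_scale(1)[OF a_cont]]
  show "((\<lambda>u. ereal (1 / v (inv_into {0..} a u)) * elog \<P>(\<omega> in M. \<exists>n. u *\<^sub>R q <e W n \<omega>)) \<longlongrightarrow>
    - (INF c\<in>{0<..}. ereal (c powr (- (V / A))) * J (c *\<^sub>R q))) at_top"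
  proof (rule Lim_transform_eventually)
    show "\<forall>\<^sub>F u in at_top. ereal (1 / v (inv_into {0..} a u)) * elog (P (a (inv_into {0..} a u))) =
      ereal (1 / v (inv_into {0..} a u)) * elog \<P>(\<omega> in M. \<exists>n. u *\<^sub>R q <e W n \<omega>)"
      using a.inv_into_regular_scale(2)[OF a_cont] by eventually_elim (simp add: P_def)
  qed
qed

end
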